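(* For every connected graph $G$ and every positive integer $k$ with $k\equiv 1 \pmod 4$, $$\gamma_{\rm sp}(S_k(G)) = \begin{cases} \frac{k+1}{2}\, m(G), & \text{if } G \text{ contains an even cycle},\\[2pt] \frac{k+1}{2}\, m(G)+1, & \text{otherwise}.\end{cases}$$
   Context: All graphs are finite, simple and undirected. $m(G)$ denotes the number of edges of $G$. "$G$ contains an even cycle" means that $G$ has a (not necessarily induced) subgraph that is a cycle of even length. For an integer $k\ge 1$, the $k$-subdivision $S_k(G)$ of $G$ is the graph obtained from $G$ by replacing each edge with a disjoint path of length $k+1$, that is, by subdividing each edge exactly $k$ times. For $D\subseteq V(G)$ write $\overline{D}=V(G)\setminus D$, and let $N_G(v)$ be the open neighborhood of $v$. A set $D\subseteq V(G)$ is a dominating set if every vertex of $\overline{D}$ has a neighbor in $D$. A dominating set $D$ is a super dominating set if for every $x\in\overline{D}$ there exists $y\in D$ such that $N_G(y)\cap\overline{D}=\{x\}$. The super domination number $\gamma_{\rm sp}(G)$ is the minimum cardinality of a super dominating set of $G$. *)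

theory Defs
  imports "Graph_Theory.Digraph_Component"
begin

text \<open>
  A finite simple undirected graph is a \<^locale>\<open>pair_graph\<close>: each edge \<open>uv\<close> is the pair of
  opposite arcs \<open>(u, v)\<close>, \<open>(v, u)\<close>.
\<close>

definition edge_count :: "'a pair_pre_digraph \<Rightarrow> nat" where
  "edge_count G = card {{u, v} | u v. (u, v) \<in> parcs G}"

text \<open>
  \<^const>\<open>pre_digraph.cycle\<close> also accepts the closed walk \<open>u, v, u\<close> along an edge and back; the
  bound \<open>3 \<le> length p\<close> excludes exactly this case. Here \<open>length p\<close> is the number of edges.
\<close>
definition contains_even_cycle :: "'a pair_pre_digraph \<Rightarrow> bool" where
  "contains_even_cycle G \<longleftrightarrow>
     (\<exists>p. pre_digraph.cycle (with_proj G) p \<and> 3 \<le> length p \<and> even (length p))"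

text \<open>
  \<open>subdiv_point k u v i\<close> is the vertex at distance \<open>i\<close> from \<open>u\<close>, for \<open>i \<le> k + 1\<close>, on the path of
  length \<open>k + 1\<close> that replaces the edge \<open>uv\<close>. A new vertex is the unordered pair of its two
  descriptions, from \<open>u\<close> and from \<open>v\<close>, so that
  \<open>subdiv_point k u v i = subdiv_point k v u (k + 1 - i)\<close> and no orientation is chosen.
\<close>
definition subdiv_point :: "nat \<Rightarrow> 'a \<Rightarrow> 'a \<Rightarrow> nat \<Rightarrow> 'a + ('a \<times> 'a \<times> nat) set" where
  "subdiv_point k u v i =
     (if i = 0 then Inl u
      else if i = k + 1 then Inl v
      else Inr {(u, v, i), (v, u, k + 1 - i)})"

definition k_subdivision ::
  "nat \<Rightarrow> 'a pair_pre_digraph \<Rightarrow> ('a + ('a \<times> 'a \<times> nat) set) pair_pre_digraph" where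
  "k_subdivision k G =
     \<lparr> pverts = Inl ` pverts G \<union> {subdiv_point k u v i | u v i. (u, v) \<in> parcs G \<and> i \<in> {1..k}},
       parcs = {(subdiv_point k u v i, subdiv_point k u v j) | u v i j.
                  (u, v) \<in> parcs G \<and> i \<le> k + 1 \<and> j \<le> k + 1 \<and> (j = i + 1 \<or> i = j + 1)} \<rparr>"

lemma subdiv_point_flip:
  "i \<le> k + 1 \<Longrightarrow> subdiv_point k v u (k + 1 - i) = subdiv_point k u v i"
  by (auto simp: subdiv_point_def)

lemma subdiv_point_neq:
  "u \<noteq> v \<Longrightarrow> i \<le> k+1 \<Longrightarrow> j \<le> k+1 \<Longrightarrow> subdiv_point k u v i = subdiv_point k u v j \<longleftrightarrow> i = j"
  by (auto simp: subdiv_point_def doubleton_eq_iff split: if_splits)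

lemma pair_graph_k_subdivision:
  assumes "pair_graph G"
  shows "pair_graph (k_subdivision k G)"
proof -
  interpret pair_graph G by fact
  have V: "subdiv_point k u v i \<in> pverts (k_subdivision k G)" if "(u,v) \<in> parcs G" "i \<le> k+1" for u v i
    using that in_arcsD1[OF that(1)] in_arcsD2[OF that(1)]
    by (cases "i = 0 \<or> i = k+1") (auto simp: k_subdivision_def subdiv_point_def, force)
  have "finite ((\<lambda>((u,v),i). subdiv_point k u v i) ` (parcs G \<times> {1..k}))"
    using pair_finite_arcs by auto
  then have "finite {subdiv_point k u v i | u v i. (u, v) \<in> parcs G \<and> i \<in> {1..k}}"
    by (rule rev_finite_subset) force
  then have fin: "finite (pverts (k_subdivision k G))"
    using pair_finite_verts by (simp add: k_subdivision_def)
  have P: "parcs (k_subdivision k G) = {(subdiv_point k u v i, subdiv_point k u v j) | u v i j.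
      (u, v) \<in> parcs G \<and> i \<le> k + 1 \<and> j \<le> k + 1 \<and> (j = i + 1 \<or> i = j + 1)}"
    by (simp add: k_subdivision_def)
  have sub: "parcs (k_subdivision k G) \<subseteq> pverts (k_subdivision k G) \<times> pverts (k_subdivision k G)"
    unfolding P using V by blast
  show ?thesis
  proof unfold_locales
    show "finite (parcs (k_subdivision k G))" using fin sub finite_subset by blast
    show "symmetric (with_proj (k_subdivision k G))"
      unfolding symmetric_def sym_def with_proj_simps P by blast
    fix e assume "e \<in> parcs (k_subdivision k G)"
    then show "fst e \<noteq> snd e"
      using no_loops' by (auto simp: P subdiv_point_neq)
  qed (use fin sub in auto)
qed

definition nbhd :: "'a pair_pre_digraph \<Rightarrow> 'a \<Rightarrow> 'a set" where
  "nbhd G v = {w. (v, w) \<in> parcs G}"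

definition dominating_set :: "'a pair_pre_digraph \<Rightarrow> 'a set \<Rightarrow> bool" where
  "dominating_set G D \<longleftrightarrow>
     D \<subseteq> pverts G \<and> (\<forall>x \<in> pverts G - D. nbhd G x \<inter> D \<noteq> {})"

definition super_dominating_set :: "'a pair_pre_digraph \<Rightarrow> 'a set \<Rightarrow> bool" where
  "super_dominating_set G D \<longleftrightarrow>
     dominating_set G D \<and>
     (\<forall>x \<in> pverts G - D. \<exists>y \<in> D. nbhd G y \<inter> (pverts G - D) = {x})"

text \<open>For finite \<open>G\<close> this is a minimum over a finite nonempty set, since \<open>pverts G\<close> qualifies.\<close>
definition super_domination_number :: "'a pair_pre_digraph \<Rightarrow> nat" where
  "super_domination_number G = Min (card ` {D. super_dominating_set G D})"

end

theory Submission
  imports Defs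
begin

text \<open>
  Write \<open>k = 4q + 1\<close> and let \<open>X\<close> be the complement of a super dominating set. Each \<open>x \<in> X\<close> forms a pair
  with a private dominator, and these pairs are disjoint edges of the subdivision. At most \<open>2q\<close> of
  them lie inside the path of a given edge of \<open>G\<close>, and each further pair uses an original vertex, so
  \<open>|X| \<le> 2q m + n\<close>. In case of equality every original vertex \<open>v\<close> is paired with the first vertex
  towards some neighbour \<open>t v\<close>, the edges \<open>{v, t v}\<close> are distinct, and along the path from \<open>v\<close> to
  \<open>t v\<close> the pairs follow each other with alternating orientation; as there are \<open>2q + 1\<close> of them, exactly
  one of \<open>v\<close> and \<open>t v\<close> lies in \<open>X\<close>. Such an alternating map \<open>t\<close> exists on all vertices iff \<open>G\<close> has an
  even cycle: iterating \<open>t\<close> runs into one, and conversely \<open>t\<close> can follow the cycle and lead all other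
  vertices towards it. Without an even cycle \<open>t\<close> can still be defined off a single root, and every
  alternating map yields a super dominating set.
\<close>

section \<open>Alternating maps and even cycles\<close>

text \<open>As \<open>v\<close> and \<open>t v\<close> are adjacent, injectivity of
  \<open>\<lambda>v. {v, t v}\<close> says that \<open>t\<close> swaps no two vertices of
  \<open>A\<close>. The colour of \<open>t v\<close> is prescribed even when \<open>t v\<close> lies
  outside \<open>A\<close>, as happens at a root.\<close>

definition alternating :: "'a pair_pre_digraph \<Rightarrow> 'a set \<Rightarrow> ('a \<Rightarrow> 'a) \<Rightarrow> ('a \<Rightarrow> bool) \<Rightarrow> bool" where
  "alternating G A t c \<longleftrightarrow>
     A \<subseteq> pverts G \<and> (\<forall>v \<in> A. (v, t v) \<in> parcs G \<and> c (t v) = (\<not> c v)) \<and> inj_on (\<lambda>v. {v, t v}) A"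

text \<open>Together with the next lemma this translates between cycles as arc lists and closed
  vertex sequences indexed by numbers.\<close>

lemma contains_even_cycleI:
  assumes "pair_wf_digraph G" "3 \<le> l" "even l" "inj_on w {..<l}" "w l = w 0"
    and arcs: "\<And>i. i < l \<Longrightarrow> (w i, w (Suc i)) \<in> parcs G"
  shows "contains_even_cycle G"
proof -
  interpret pair_wf_digraph G by fact
  define p where "p n = map (\<lambda>i. (w i, w (Suc i))) [0..<n]" for n
  have cas: "pcas (w i) (map (\<lambda>i. (w i, w (Suc i))) [i..<i + n]) (w (i + n))" for i n
  proof (induction n arbitrary: i)
    case (Suc n)
    show ?case using Suc[of "Suc i"] by (simp add: upt_conv_Cons del: upt_Suc)
  qed simp
  have *: "pcas (w 0) (p l) (w 0)"
    using cas[of 0 l] assms(5) by (simp add: p_def)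
  have "awalk (w 0) (p l) (w 0)"
    unfolding awalk_def using * arcs in_arcsD1[OF arcs[of 0]] assms(2) by (auto simp: p_def)
  moreover have "distinct (tl (pawalk_verts (w 0) (p l)))"
  proof -
    have ne: "p l \<noteq> []" using assms(2) by (simp add: p_def)
    have "pawalk_verts (w 0) (p l) = w 0 # map snd (p l)"
      using awalk_verts_conv'[OF *] ne assms(2) by (simp add: p_def hd_map)
    moreover have "map snd (p l) = map w [Suc 0..<Suc l]"
      by (simp add: p_def map_Suc_upt[symmetric] o_def del: upt_Suc)
    \<comment> \<open>The tail of the vertex list has the indices 1 to \<open>l\<close>, while
      injectivity is known from 0 to \<open>l - 1\<close>; reduction modulo \<open>l\<close>
      identifies the ends.\<close>
    moreover have "inj_on w {Suc 0..<Suc l}"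
    proof (rule inj_onI)
      fix i j assume ij: "i \<in> {Suc 0..<Suc l}" "j \<in> {Suc 0..<Suc l}" "w i = w j"
      have r: "w i = w (i mod l)" if "i \<le> l" for i
        using that assms(5) by (cases "i = l") auto
      have "i mod l = j mod l"
        using ij r[of i] r[of j] inj_onD[OF assms(4), of "i mod l" "j mod l"] assms(2) by auto
      then show "i = j" using ij by (cases "i = l"; cases "j = l") auto
    qed
    ultimately show ?thesis by (simp add: distinct_map del: upt_Suc)
  qed
  ultimately have "cycle (p l)" using assms(2) by (auto simp: cycle_def p_def)
  then show ?thesis
    unfolding contains_even_cycle_def using assms(2,3) by (intro exI[of _ "p l"]) (auto simp: p_def)
qed

lemma contains_even_cycleE:
  assumes "pair_wf_digraph G" "contains_even_cycle G"
  obtains w l where "3 \<le> l" "even l" "inj_on w {..<l}" "w l = w 0"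
    "\<And>i. i < l \<Longrightarrow> (w i, w (Suc i)) \<in> parcs G"
proof -
  interpret pair_wf_digraph G by fact
  obtain p u where p: "awalk u p u" "distinct (tl (pawalk_verts u p))" "3 \<le> length p" "even (length p)"
    using assms(2) by (auto simp: contains_even_cycle_def cycle_def)
  define w where "w i = pawalk_verts u p ! i" for i
  let ?l = "length p"
  have len: "length (pawalk_verts u p) = Suc ?l" by (rule length_awalk_verts)
  have conv: "pawalk_verts u p = map fst p @ [snd (last p)]"
    using p(3) by (simp add: awalk_verts_conv) auto
  have conv': "pawalk_verts u p = fst (hd p) # map snd p"
    using awalk_verts_conv'[of u p u] p(1,3) by (auto simp: awalk_def)
  have arc: "(w i, w (Suc i)) = p ! i" if "i < ?l" for i
  proof -
    have "w i = fst (p ! i)" using that by (simp add: w_def conv nth_append)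
    moreover have "w (Suc i) = snd (p ! i)" using that by (simp add: w_def conv')
    ultimately show ?thesis by simp
  qed
  have w0: "w 0 = u" "w ?l = u"
    using awhd_if_cas[of u p u] awlast_if_cas[of u p u] p(1) len
    by (auto simp: w_def awalk_def hd_conv_nth last_conv_nth)
  have inj: "inj_on w {Suc 0..?l}"
    using p(2) len unfolding inj_on_def w_def
    by (auto simp: distinct_conv_nth nth_tl) (metis Suc_le_D Suc_le_lessD Suc_inject)
  have "inj_on w {..<?l}"
  proof (rule inj_onI)
    fix i j assume ij: "i \<in> {..<?l}" "j \<in> {..<?l}" "w i = w j"
    let ?s = "\<lambda>i. if i = 0 then ?l else i"
    have "w (?s i) = w (?s j)" using ij w0 by auto
    then have "?s i = ?s j" using inj_onD[OF inj, of "?s i" "?s j"] ij by (auto split: if_splits)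
    then show "i = j" using ij by (auto split: if_splits)
  qed
  moreover have "(w i, w (Suc i)) \<in> parcs G" if "i < ?l" for i
    using arc[OF that] p(1) that by (auto simp: awalk_def)
  ultimately show thesis using that[of ?l w] p(3,4) w0 by auto
qed

text \<open>A walk from \<open>W\<close> to its complement must leave \<open>W\<close>; the reverse
  of the arc by which it leaves is the required one. Symmetry also turns connectedness, which speaks
  of the symmetric closure, into reachability in \<open>G\<close>.\<close>

lemma connected_boundary_arc:
  assumes "pair_graph G" "Digraph_Component.connected (with_proj G)"
    and "W \<subset> pverts G" "W \<noteq> {}"
  obtains v w where "v \<in> pverts G - W" "w \<in> W" "(v, w) \<in> parcs G"
proof -
  interpret pair_graph G by fact
  obtain a b where ab: "a \<in> W" "b \<in> pverts G - W" using assms(3,4) by blast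
  have "a \<rightarrow>\<^sup>*\<^bsub>mk_symmetric (with_proj G)\<^esub> b"
    using assms(2,3) ab by (auto simp: connected_def strongly_connected_def)
  then have "a \<rightarrow>\<^sup>*\<^bsub>with_proj G\<^esub> b"
    using reachable_mk_symmetric_eq[OF sym_arcs] by simp
  then have "b \<in> W \<or> (\<exists>v \<in> pverts G - W. \<exists>w \<in> W. (v, w) \<in> parcs G)"
  proof (induction rule: reachable_induct)
    case (step x y)
    then have "(x, y) \<in> parcs G" "(y, x) \<in> parcs G" "y \<in> pverts G"
      using arcs_symmetric in_arcsD2 by simp_all
    with step(3) show ?case by blast
  qed (use ab in auto)
  then show thesis using ab that by blast
qed

text \<open>The map grows by one vertex at a time: some \<open>v\<close> outside \<open>W\<close>
  with a neighbour \<open>w\<close> in \<open>W\<close> is sent to \<open>w\<close> and gets the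
  opposite colour. Its edge is new because no earlier edge contains \<open>v\<close>. Keeping
  \<open>W\<close> apart from \<open>A\<close> allows for a root in \<open>W - A\<close>.\<close>

lemma alternating_extend:
  assumes "pair_graph G" "Digraph_Component.connected (with_proj G)"
    and "W \<subseteq> pverts G" "W \<noteq> {}" "A \<subseteq> W" "t ` A \<subseteq> W" "alternating G A t c"
  shows "\<exists>t' c'. alternating G (A \<union> (pverts G - W)) t' c' \<and> (\<forall>v \<in> W. c' v = c v)"
  using assms(3-)
proof (induction "card (pverts G - W)" arbitrary: W A t c rule: less_induct)
  case less
  interpret pair_graph G by fact
  show ?case
  proof (cases "W = pverts G")
    case True
    then show ?thesis using less.prems by auto
  next
    case False
    then obtain v w where vw: "v \<in> pverts G - W" "w \<in> W" "(v, w) \<in> parcs G"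
      using connected_boundary_arc[OF assms(1,2)] less.prems by blast
    let ?t = "t(v := w)" and ?c = "c(v := \<not> c w)"
    have vA: "v \<notin> A" and tA: "\<And>u. u \<in> A \<Longrightarrow> t u \<noteq> v \<and> u \<noteq> v" using vw less.prems by auto
    have "alternating G (insert v A) ?t ?c"
      unfolding alternating_def
    proof (intro conjI ballI)
      show "inj_on (\<lambda>u. {u, ?t u}) (insert v A)"
      proof (rule inj_on_insert[THEN iffD2], intro conjI)
        show "inj_on (\<lambda>u. {u, ?t u}) A"
          using less.prems(5) tA by (auto simp: alternating_def inj_on_def)
        show "{v, ?t v} \<notin> (\<lambda>u. {u, ?t u}) ` (A - {v})"
        proof
          assume "{v, ?t v} \<in> (\<lambda>u. {u, ?t u}) ` (A - {v})"
          then obtain u where "u \<in> A" "v \<in> {u, t u}" by auto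
          then show False using tA[of u] by auto
        qed
      qed
    qed (use vw less.prems tA in \<open>auto simp: alternating_def\<close>)
    moreover have "card (pverts G - insert v W) < card (pverts G - W)"
      using vw pair_finite_verts by (intro psubset_card_mono) auto
    ultimately obtain t' c' where *: "alternating G (insert v A \<union> (pverts G - insert v W)) t' c'"
        "\<forall>u \<in> insert v W. c' u = ?c u"
      using less.hyps[of "insert v W" "insert v A" ?t ?c] vw less.prems by (auto simp: image_subset_iff)
    moreover have "insert v A \<union> (pverts G - insert v W) = A \<union> (pverts G - W)" using vw by auto
    ultimately have "alternating G (A \<union> (pverts G - W)) t' c'" "\<forall>u \<in> W. c' u = c u"
      using vw by auto
    then show ?thesis by blast
  qed
qed

text \<open>Extension from a single vertex \<open>r\<close> makes \<open>t\<close> the parent map of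
  a spanning tree with root \<open>r\<close>. The colour of \<open>r\<close> is false because the
  later construction needs every vertex of the other colour in the domain of
  \<open>t\<close>.\<close>

lemma alternating_remove_root:
  assumes "pair_graph G" "Digraph_Component.connected (with_proj G)"
  obtains r t c where "r \<in> pverts G" "alternating G (pverts G - {r}) t c" "\<not> c r"
proof -
  obtain r where "r \<in> pverts G"
    using assms(2) by (auto simp: connected_def strongly_connected_def)
  moreover have "alternating G {} id (\<lambda>_. False)" by (simp add: alternating_def)
  ultimately obtain t c where "alternating G ({} \<union> (pverts G - {r})) t c" "\<forall>v \<in> {r}. c v = False"
    using alternating_extend[OF assms, of "{r}" "{}" id "\<lambda>_. False"] by auto
  with \<open>r \<in> pverts G\<close> that show thesis by auto
qed

text \<open>On the cycle, \<open>t\<close> is the successor and \<open>c\<close> the parity of the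
  position: even length makes the colours fit at the closing edge, and length at least 3 keeps the
  edges distinct. All other vertices are attached by extension.\<close>

lemma even_cycle_imp_alternating:
  assumes "pair_graph G" "Digraph_Component.connected (with_proj G)" "contains_even_cycle G"
  obtains t c where "alternating G (pverts G) t c"
proof -
  interpret pair_graph G by fact
  obtain w l where l: "3 \<le> l" "even l" and inj: "inj_on w {..<l}" and wl: "w l = w 0"
    and arcs: "\<And>i. i < l \<Longrightarrow> (w i, w (Suc i)) \<in> parcs G"
    using contains_even_cycleE[OF pair_wf_digraph assms(3)] by metis
  define C where "C = w ` {..<l}"
  define i where "i = the_inv_into {..<l} w"
  have i: "i (w j) = j" if "j < l" for j
    unfolding i_def using inj that by (simp add: the_inv_into_f_f)
  define t where "t v = w (Suc (i v))" for v
  define c where "c v = even (i v)" for v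
  have wS: "w (Suc j) = w (Suc j mod l)" if "j < l" for j
    using that wl by (cases "Suc j = l") auto
  have "alternating G C t c"
    unfolding alternating_def
  proof (intro conjI ballI)
    show "C \<subseteq> pverts G" using arcs in_arcsD1 by (auto simp: C_def)
    show "(v, t v) \<in> parcs G" if "v \<in> C" for v using that arcs by (auto simp: C_def t_def i)
    show "c (t v) = (\<not> c v)" if "v \<in> C" for v
    proof -
      obtain j where j: "j < l" "v = w j" using \<open>v \<in> C\<close> by (auto simp: C_def)
      have "i (t v) = Suc j mod l" using j l wS[OF j(1)] by (simp add: t_def i)
      moreover have "even (Suc j mod l) = even (Suc j)" using l(2) by (simp add: dvd_mod_iff)
      ultimately show ?thesis using j by (simp add: c_def i)
    qed
    show "inj_on (\<lambda>v. {v, t v}) C"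
    proof (rule inj_onI)
      fix u v assume uv: "u \<in> C" "v \<in> C" "{u, t u} = {v, t v}"
      obtain j j' where j: "j < l" "u = w j" "j' < l" "v = w j'" using uv by (auto simp: C_def)
      show "u = v"
      proof (rule ccontr)
        assume "u \<noteq> v"
        then have "w j = w (Suc j' mod l)" "w j' = w (Suc j mod l)"
          using uv(3) j wS by (auto simp: doubleton_eq_iff t_def i)
        moreover have "Suc i mod l \<in> {..<l}" for i using l(1) by simp
        ultimately have "j = Suc j' mod l" and 1: "j' = Suc j mod l"
          using inj_onD[OF inj] j(1,3) by (meson lessThan_iff)+
        then have "j = Suc (Suc j mod l) mod l" by simp
        then show False using l(1) j(1) by (auto simp: mod_Suc split: if_splits)
      qed
    qed
  qed
  moreover have "t ` C \<subseteq> C" using wS l by (auto simp: C_def t_def i)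
  moreover have "C \<subseteq> pverts G" using arcs in_arcsD1 by (auto simp: C_def)
  moreover have "w 0 \<in> C" using l(1) by (simp add: C_def)
  then have "C \<noteq> {}" by blast
  moreover from calculation have "C \<union> (pverts G - C) = pverts G" by auto
  ultimately show thesis
    using alternating_extend[OF assms(1,2), of C C t c] that by auto
qed

text \<open>The cycle is the periodic part of the orbits of \<open>t\<close>; distinctness of the edges \<open>{v, t v}\<close>
  excludes period 2, and the colouring makes the period even.\<close>
lemma alternating_imp_even_cycle:
  assumes "pair_graph G" "pverts G \<noteq> {}" "alternating G (pverts G) t c"
  shows "contains_even_cycle G"
proof -
  interpret pair_graph G by fact
  have arc: "(v, t v) \<in> parcs G" and col: "c (t v) = (\<not> c v)" if "v \<in> pverts G" for v
    using assms(3) that by (auto simp: alternating_def)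
  have inj: "inj_on (\<lambda>v. {v, t v}) (pverts G)" using assms(3) by (simp add: alternating_def)
  obtain v where v: "v \<in> pverts G" using assms(2) by auto
  have orb: "(t ^^ i) u \<in> pverts G" if "u \<in> pverts G" for i u
    by (induction i) (use that arc in_arcsD2 in auto)
  have "\<not> inj (\<lambda>i. (t ^^ i) v)"
  proof
    assume "inj (\<lambda>i. (t ^^ i) v)"
    moreover have "finite (range (\<lambda>i. (t ^^ i) v))"
      by (rule finite_subset[OF _ pair_finite_verts]) (use orb[OF v] in auto)
    ultimately show False by (auto dest: finite_imageD)
  qed
  then obtain i j where ij: "i < j" "(t ^^ i) v = (t ^^ j) v"
    unfolding inj_def by (metis linorder_neqE_nat)
  define u where "u = (t ^^ i) v"
  have u: "u \<in> pverts G" using orb[OF v] by (simp add: u_def)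
  have ex: "(t ^^ (j - i)) u = u" "0 < j - i"
    using ij funpow_add[of "j - i" i t] by (simp_all add: u_def)
  \<comment> \<open>Minimality makes the orbit of \<open>u\<close> injective below \<open>l\<close>:
    a repetition at \<open>a < b\<close> would, after \<open>l - b\<close> further steps, return to
    \<open>u\<close> too early.\<close>
  define l where "l = (LEAST n. 0 < n \<and> (t ^^ n) u = u)"
  have l: "0 < l" "(t ^^ l) u = u" 
    using LeastI[of "\<lambda>n. 0 < n \<and> (t ^^ n) u = u" "j - i"] ex by (auto simp: l_def)
  have least: "\<not> (0 < n \<and> (t ^^ n) u = u)" if "n < l" for n
    using not_less_Least that unfolding l_def by blast
  have winj: "inj_on (\<lambda>i. (t ^^ i) u) {..<l}"
  proof (rule linorder_inj_onI)
    fix a b assume ab: "a < b" "a \<in> {..<l}" "b \<in> {..<l}"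
    show "(t ^^ a) u \<noteq> (t ^^ b) u"
    proof
      assume "(t ^^ a) u = (t ^^ b) u"
      then have "(t ^^ (l - b)) ((t ^^ a) u) = (t ^^ (l - b)) ((t ^^ b) u)" by simp
      then have "(t ^^ (l - b + a)) u = u"
        using l ab funpow_add[of "l - b" a t] funpow_add[of "l - b" b t] by simp
      then show False using least[of "l - b + a"] ab by auto
    qed
  qed auto
  have "c ((t ^^ i) u) = (c u = even i)" for i
    by (induction i) (use col orb[OF u] in auto)
  from this[of l] have "even l" using l by auto
  moreover have "l \<noteq> 2"
  proof
    assume "l = 2"
    then have "t (t u) = u" using l by (simp add: numeral_2_eq_2)
    then have "t u = u" using inj_onD[OF inj, of u "t u"] u arc[OF u] in_arcsD2 by (auto simp: insert_commute)
    then show False using col[OF u] by simp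
  qed
  ultimately have "3 \<le> l" using l(1) by presburger
  then show ?thesis
    by (rule contains_even_cycleI[OF pair_wf_digraph _ \<open>even l\<close> winj])
      (use l(2) arc[OF orb[OF u]] in simp_all)
qed

section \<open>The lower bound\<close>

definition orientation :: "'a pair_pre_digraph \<Rightarrow> ('a \<times> 'a) set \<Rightarrow> bool" where
  "orientation G R \<longleftrightarrow>
     R \<subseteq> parcs G \<and> (\<forall>u v. (u, v) \<in> parcs G \<longrightarrow> ((u, v) \<in> R) \<noteq> ((v, u) \<in> R))"

text \<open>Edges without an arc in \<open>P\<close> are directed upwards along an injective
  numbering of the vertices. The lower bound takes \<open>P\<close> empty; the construction
  prescribes arcs.\<close>

lemma orientation_extend:
  assumes "pair_graph G" "P \<subseteq> parcs G" "\<And>u v. (u, v) \<in> P \<Longrightarrow> (v, u) \<notin> P"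
  obtains R where "orientation G R" "P \<subseteq> R"
proof -
  interpret pair_graph G by fact
  obtain f :: "'a \<Rightarrow> nat" where f: "inj_on f (pverts G)"
    using finite_imp_inj_to_nat_seg[OF pair_finite_verts] by blast
  define R where "R = P \<union> {(u, v) \<in> parcs G. f u < f v \<and> (v, u) \<notin> P}"
  have "((u, v) \<in> R) \<noteq> ((v, u) \<in> R)" if uv: "(u, v) \<in> parcs G" for u v
  proof -
    have "f u \<noteq> f v"
      using inj_onD[OF f] no_loops'[OF uv] in_arcsD1[OF uv] in_arcsD2[OF uv] by blast
    then show ?thesis
      using uv arcs_symmetric[OF uv] assms(3)[of u v] assms(3)[of v u] by (auto simp: R_def)
  qed
  then have "orientation G R" using assms(2) by (auto simp: orientation_def R_def)
  then show thesis using that by (auto simp: R_def)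
qed

lemma edge_count_eq_card_orientation:
  assumes "pair_graph G" "orientation G R"
  shows "edge_count G = card R"
proof -
  interpret pair_graph G by fact
  have R: "R \<subseteq> parcs G" "\<And>u v. (u, v) \<in> parcs G \<Longrightarrow> ((u, v) \<in> R) \<noteq> ((v, u) \<in> R)"
    using assms(2) by (auto simp: orientation_def)
  have "inj_on (\<lambda>(u, v). {u, v}) R"
    using R by (auto simp: inj_on_def doubleton_eq_iff)
  moreover have "(\<lambda>(u, v). {u, v}) ` R = {{u, v} | u v. (u, v) \<in> parcs G}"
  proof (intro equalityI subsetI)
    fix e assume "e \<in> {{u, v} | u v. (u, v) \<in> parcs G}"
    then obtain u v where "e = {u, v}" "(u, v) \<in> parcs G" by auto
    then have "e = {u, v} \<and> (u, v) \<in> R \<or> e = {v, u} \<and> (v, u) \<in> R" using R(2) by auto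
    then show "e \<in> (\<lambda>(u, v). {u, v}) ` R" by force
  qed (use R(1) in auto)
  ultimately have "edge_count G = card ((\<lambda>(u, v). {u, v}) ` R)" by (simp only: edge_count_def)
  with \<open>inj_on _ R\<close> show ?thesis by (simp only: card_image)
qed

section \<open>Vertices, paths and neighbourhoods of the subdivision\<close>

locale oriented_subdivision = pair_graph G for G :: "'a pair_pre_digraph" +
  fixes k :: nat and R :: "('a \<times> 'a) set"
  assumes orientation: "orientation G R" and k_pos: "0 < k"
begin

abbreviation S where "S \<equiv> k_subdivision k G"
abbreviation pt where "pt \<equiv> subdiv_point k"
abbreviation inner where "inner u v \<equiv> pt u v ` {1..k}"

lemma R_arcs: "(u, v) \<in> R \<Longrightarrow> (u, v) \<in> parcs G"
  and R_cases: "(u, v) \<in> parcs G \<Longrightarrow> ((v, u) \<in> R) \<longleftrightarrow> ((u, v) \<notin> R)"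
  using orientation by (auto simp: orientation_def)

lemma finite_R: "finite R"
  using finite_subset[OF _ pair_finite_arcs] orientation by (auto simp: orientation_def)

lemma pt_0 [simp]: "pt u v 0 = Inl u"
  and pt_Suc_k [simp]: "pt u v (Suc k) = Inl v"
  by (auto simp: subdiv_point_def)

lemma pt_inner: "i \<in> {1..k} \<Longrightarrow> pt u v i = Inr {(u, v, i), (v, u, k + 1 - i)}"
  by (auto simp: subdiv_point_def)

lemma pt_flip: "i \<le> Suc k \<Longrightarrow> pt u v (Suc k - i) = pt v u i"
  using subdiv_point_flip[of i k u v] by simp

lemma pt_inner_eq_iff:
  assumes "i \<in> {1..k}" "j \<in> {1..k}"
  shows "pt u v i = pt u' v' j \<longleftrightarrow>
    u' = u \<and> v' = v \<and> j = i \<or> u' = v \<and> v' = u \<and> j = Suc k - i"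
  using assms by (auto simp: pt_inner doubleton_eq_iff)

lemma pt_inner_neq_Inl: "i \<in> {1..k} \<Longrightarrow> pt u v i \<noteq> Inl x"
  by (simp add: pt_inner)

text \<open>An inner vertex has one description from each end of its edge, and only one of the two
  directions lies in \<open>R\<close>.\<close>

lemma pt_R_inj:
  assumes "i \<in> {1..k}" "j \<in> {1..k}" "(u, v) \<in> R" "(u', v') \<in> R" "pt u v i = pt u' v' j"
  shows "u' = u \<and> v' = v \<and> j = i"
  using assms R_cases[OF R_arcs] by (auto simp: pt_inner_eq_iff)

lemma pt_inj_on: "(u, v) \<in> parcs G \<Longrightarrow> inj_on (pt u v) {..Suc k}"
  by (rule inj_onI) (use subdiv_point_neq[of u v _ k] no_loops' in auto)

lemma inner_flip: "inner v u = inner u v"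
proof -
  have "inner v u \<subseteq> inner u v" for u v
  proof
    fix p assume "p \<in> inner v u"
    then obtain i where "i \<in> {1..k}" "p = pt v u i" by blast
    then have "p = pt u v (Suc k - i)" "Suc k - i \<in> {1..k}" using pt_flip[of i u v] by auto
    then show "p \<in> inner u v" by blast
  qed
  then show ?thesis by (intro equalityI)
qed

lemma card_inner: "(u, v) \<in> parcs G \<Longrightarrow> card (inner u v) = k"
  using card_image[OF inj_on_subset[OF pt_inj_on]] by fastforce

lemma pverts_S: "pverts S = Inl ` pverts G \<union> (\<Union>(u, v) \<in> R. inner u v)"
proof -
  have "{pt u v i | u v i. (u, v) \<in> parcs G \<and> i \<in> {1..k}} = (\<Union>(u, v) \<in> R. inner u v)"
  proof (intro equalityI subsetI)
    fix p assume "p \<in> {pt u v i | u v i. (u, v) \<in> parcs G \<and> i \<in> {1..k}}"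
    then obtain u v where "(u, v) \<in> parcs G" "p \<in> inner u v" by blast
    then show "p \<in> (\<Union>(u, v) \<in> R. inner u v)"
      using R_cases[of u v] inner_flip[of u v] by (cases "(u, v) \<in> R") blast+
  qed (use R_arcs in blast)
  then show ?thesis by (simp add: k_subdivision_def)
qed

lemma finite_pverts_S: "finite (pverts S)"
  using pair_finite_verts finite_R by (auto simp: pverts_S)

lemma inner_disjoint:
  assumes "e \<in> R" "e' \<in> R" "e \<noteq> e'"
  shows "(case e of (u, v) \<Rightarrow> inner u v) \<inter> (case e' of (u, v) \<Rightarrow> inner u v) = {}"
  using assms pt_R_inj by (auto split: prod.splits)

lemma card_pverts_S: "card (pverts S) = card (pverts G) + k * card R"
proof -
  have "card (\<Union>(u, v) \<in> R. inner u v) = (\<Sum>(u, v) \<in> R. card (inner u v))"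
    using card_UN_disjoint[OF finite_R, of "\<lambda>(u, v). inner u v"] inner_disjoint
    by (auto simp: case_prod_unfold)
  also have "\<dots> = (\<Sum>e \<in> R. k)"
    by (rule sum.cong) (use card_inner R_arcs in force)+
  finally have "card (\<Union>(u, v) \<in> R. inner u v) = k * card R" by simp
  moreover have "Inl ` pverts G \<inter> (\<Union>(u, v) \<in> R. inner u v) = {}"
    by (auto simp: pt_inner)
  ultimately show ?thesis
    unfolding pverts_S using pair_finite_verts finite_R
    by (subst card_Un_disjoint) (auto simp: card_image)
qed

lemma parcs_S: "parcs S = {(pt u v i, pt u v j) | u v i j.
    (u, v) \<in> parcs G \<and> i \<le> k + 1 \<and> j \<le> k + 1 \<and> (j = i + 1 \<or> i = j + 1)}"
  by (simp add: k_subdivision_def)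

text \<open>A backward step on the path from \<open>u\<close> to \<open>v\<close> is a forward step
  on the path from \<open>v\<close> to \<open>u\<close>, so forward steps describe all arcs.\<close>

lemma parcs_S_iff:
  "(p, q) \<in> parcs S \<longleftrightarrow> (\<exists>u v i. (u, v) \<in> parcs G \<and> i \<le> k \<and> p = pt u v i \<and> q = pt u v (Suc i))"
  (is "?L \<longleftrightarrow> ?E")
proof
  assume ?L
  then obtain u v i j where *: "(u, v) \<in> parcs G" "i \<le> k + 1" "j \<le> k + 1" "j = i + 1 \<or> i = j + 1"
      "p = pt u v i" "q = pt u v j"
    unfolding parcs_S by blast
  show ?E
  proof (cases "j = i + 1")
    case False
    then have "p = pt v u (Suc k - i)" "q = pt v u (Suc (Suc k - i))" "Suc k - i \<le> k"
      using * pt_flip[of i v u] pt_flip[of j v u] by (auto simp: Suc_diff_le)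
    then show ?thesis using arcs_symmetric[OF *(1)] by blast
  qed (use * in auto)
next
  assume ?E
  then obtain u v i where "(u, v) \<in> parcs G" "i \<le> k" "p = pt u v i" "q = pt u v (Suc i)" by blast
  then have "(u, v) \<in> parcs G \<and> i \<le> k + 1 \<and> Suc i \<le> k + 1 \<and> (Suc i = i + 1 \<or> i = Suc i + 1) \<and>
      p = pt u v i \<and> q = pt u v (Suc i)" by simp
  then show ?L unfolding parcs_S by blast
qed

lemma nbhd_inner:
  assumes "(u, v) \<in> parcs G" "i \<in> {1..k}"
  shows "nbhd S (pt u v i) = {pt u v (i - 1), pt u v (Suc i)}"
proof (intro equalityI subsetI)
  fix q assume "q \<in> nbhd S (pt u v i)"
  then obtain u' v' j where *: "(u', v') \<in> parcs G" "j \<le> k" "pt u v i = pt u' v' j" "q = pt u' v' (Suc j)"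
    by (auto simp: nbhd_def parcs_S_iff)
  moreover have "j \<noteq> 0" using * assms pt_inner_neq_Inl[of i u v] by (cases j) auto
  ultimately have "u' = u \<and> v' = v \<and> j = i \<or> u' = v \<and> v' = u \<and> j = Suc k - i"
    using assms pt_inner_eq_iff[of i j u v u' v'] by auto
  \<comment> \<open>The successor of position \<open>Suc k - i\<close>, counted from
    \<open>v\<close>, is the predecessor of position \<open>i\<close>, counted from
    \<open>u\<close>.\<close>
  moreover have "pt v u (Suc (Suc k - i)) = pt u v (i - 1)"
  proof -
    have "Suc (Suc k - i) \<le> Suc k" "Suc k - Suc (Suc k - i) = i - 1" using assms(2) by auto
    then show ?thesis using pt_flip[of "Suc (Suc k - i)" u v] by metis
  qed
  ultimately show "q \<in> {pt u v (i - 1), pt u v (Suc i)}" using * by auto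
next
  fix q assume q: "q \<in> {pt u v (i - 1), pt u v (Suc i)}"
  have "(pt u v i, pt u v (i - 1)) \<in> parcs S" "(pt u v i, pt u v (Suc i)) \<in> parcs S"
    unfolding parcs_S using assms by force+
  then show "q \<in> nbhd S (pt u v i)" using q by (auto simp: nbhd_def)
qed

lemma nbhd_Inl: "nbhd S (Inl v) = {pt v u 1 | u. (v, u) \<in> parcs G}"
proof (intro equalityI subsetI)
  fix q assume "q \<in> nbhd S (Inl v)"
  then obtain u' v' j where *: "(u', v') \<in> parcs G" "j \<le> k" "Inl v = pt u' v' j" "q = pt u' v' (Suc j)"
    by (auto simp: nbhd_def parcs_S_iff)
  then have "j = 0" using pt_inner_neq_Inl[of j u' v' v] by (cases j) auto
  then show "q \<in> {pt v u 1 | u. (v, u) \<in> parcs G}" using * by auto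
qed (force simp: nbhd_def parcs_S_iff)

end

text \<open>\<open>U\<close> consists of the vertices of \<open>X\<close> and their chosen private dominators, and \<open>m\<close> swaps each
  vertex of \<open>X\<close> with its dominator.\<close>
definition private_matching ::
  "'a pair_pre_digraph \<Rightarrow> 'a set \<Rightarrow> 'a set \<Rightarrow> ('a \<Rightarrow> 'a) \<Rightarrow> bool" where
  "private_matching G X U m \<longleftrightarrow>
     X \<subseteq> U \<and> U \<subseteq> pverts G \<and>
     (\<forall>p \<in> U. m p \<in> U \<and> m (m p) = p \<and> (p, m p) \<in> parcs G \<and> (m p \<in> X) = (p \<notin> X)) \<and>
     (\<forall>p \<in> U. \<forall>q \<in> U. (p, q) \<in> parcs G \<longrightarrow> q \<noteq> m p \<longrightarrow> (q \<in> X) = (p \<in> X))"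

text \<open>A private dominator determines its vertex, so the choice \<open>f\<close> is injective
  and \<open>m\<close> can swap \<open>x\<close> with \<open>f x\<close>. If just one of two
  adjacent vertices of \<open>U\<close> is in \<open>X\<close>, the other is some
  \<open>f x\<close>, whose only neighbour in \<open>X\<close> is \<open>x\<close>; so they are
  partners.\<close>

lemma super_dominating_set_imp_private_matching:
  assumes "pair_graph G" "super_dominating_set G D"
  obtains U m where "private_matching G (pverts G - D) U m"
proof -
  interpret pair_graph G by fact
  define X where "X = pverts G - D"
  have D: "D \<subseteq> pverts G" using assms(2) by (auto simp: super_dominating_set_def dominating_set_def)
  have "\<forall>x \<in> X. \<exists>y \<in> D. nbhd G y \<inter> X = {x}"
    using assms(2) by (simp add: super_dominating_set_def X_def)
  then obtain f where f: "\<And>x. x \<in> X \<Longrightarrow> f x \<in> D" "\<And>x. x \<in> X \<Longrightarrow> nbhd G (f x) \<inter> X = {x}"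
    by metis
  have inj: "inj_on f X"
    by (rule inj_onI) (metis f(2) singleton_inject)
  have fX: "f x \<notin> X" if "x \<in> X" for x using f(1)[OF that] by (simp add: X_def)
  define U where "U = X \<union> f ` X"
  define m where "m p = (if p \<in> X then f p else the_inv_into X f p)" for p
  have m_X: "m x = f x" "m (f x) = x" if "x \<in> X" for x
    using that fX inj by (auto simp: m_def the_inv_into_f_f)
  have adj: "(x, f x) \<in> parcs G" "(f x, x) \<in> parcs G" if "x \<in> X" for x
    using f(2)[OF that] arcs_symmetric by (auto simp: nbhd_def)
  have priv: "q \<in> X \<Longrightarrow> (f x, q) \<in> parcs G \<Longrightarrow> x \<in> X \<Longrightarrow> q = x" for x q
    using f(2)[of x] by (auto simp: nbhd_def)
  have "private_matching G X U m"
    unfolding private_matching_def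
  proof (intro conjI ballI impI)
    fix p q assume pq: "p \<in> U" "q \<in> U" "(p, q) \<in> parcs G" "q \<noteq> m p"
    have "(q, p) \<in> parcs G" using arcs_symmetric pq(3) .
    then show "(q \<in> X) = (p \<in> X)" using pq m_X priv by (fastforce simp: U_def)
  qed (use D f(1) fX m_X adj in \<open>auto simp: U_def X_def\<close>)
  then show thesis using that by (simp add: X_def)
qed

text \<open>The involution \<open>m\<close> exchanges \<open>W \<inter> X\<close> and
  \<open>W - X\<close>.\<close>

lemma private_matching_card:
  assumes "private_matching G X U m" "W \<subseteq> U" "m ` W \<subseteq> W" "finite W"
  shows "card W = 2 * card (W \<inter> X)"
proof -
  have m: "\<And>p. p \<in> W \<Longrightarrow> m p \<in> W \<and> m (m p) = p \<and> (m p \<in> X) = (p \<notin> X)"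
    using assms(1-3) unfolding private_matching_def by blast
  then have "bij_betw m (W \<inter> X) (W - X)"
    by (intro bij_betw_byWitness[of _ m]) auto
  then have "card (W \<inter> X) = card (W - X)" by (rule bij_betw_same_card)
  then show ?thesis using card_Int_Diff[OF assms(4), of X] by simp
qed

section \<open>Counting pairs along the subdivided edges\<close>

locale matched_subdivision = oriented_subdivision G k R
  for G :: "'a pair_pre_digraph" and k R +
  fixes X U m
  assumes matching: "private_matching S X U m"
begin

lemma X_U: "X \<subseteq> U" and U_S: "U \<subseteq> pverts S"
  and m_U: "p \<in> U \<Longrightarrow> m p \<in> U" and m_m: "p \<in> U \<Longrightarrow> m (m p) = p"
  and m_nbhd: "p \<in> U \<Longrightarrow> m p \<in> nbhd S p" and m_X: "p \<in> U \<Longrightarrow> m p \<in> X \<longleftrightarrow> p \<notin> X"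
  and same_type: "p \<in> U \<Longrightarrow> q \<in> U \<Longrightarrow> q \<in> nbhd S p \<Longrightarrow> q \<noteq> m p \<Longrightarrow> q \<in> X \<longleftrightarrow> p \<in> X"
  using matching unfolding private_matching_def nbhd_def by blast+

lemma finite_U: "finite U" using U_S finite_pverts_S finite_subset by blast

definition matched_inside where "matched_inside u v = {p \<in> inner u v \<inter> U. m p \<in> inner u v}"

lemma card_matched_inside: "card (matched_inside u v) = 2 * card (matched_inside u v \<inter> X)"
  using private_matching_card[OF matching, of "matched_inside u v"] finite_U m_U m_m
  by (auto simp: matched_inside_def image_subset_iff)

lemma card_matched_inside_le:
  assumes "(u, v) \<in> parcs G"
  shows "card (matched_inside u v \<inter> X) \<le> k div 2"
proof -
  have "card (matched_inside u v) \<le> card (inner u v)"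
    by (rule card_mono) (auto simp: matched_inside_def)
  then show ?thesis using card_matched_inside[of u v] card_inner[OF assms] by linarith
qed

definition touching where "touching = {x \<in> X. x \<in> Inl ` pverts G \<or> m x \<in> Inl ` pverts G}"

text \<open>The map \<open>g\<close> picks the original vertex of a pair. There is only one, since
  for \<open>0 < k\<close> no two original vertices are adjacent in the subdivision.\<close>

lemma card_touching: "card touching = card {v \<in> pverts G. Inl v \<in> U}"
proof -
  define g where "g x = (if x \<in> Inl ` pverts G then x else m x)" for x
  have "inj_on g touching"
    using X_U m_m m_X unfolding touching_def g_def inj_on_def by (smt (verit) mem_Collect_eq subsetD)
  moreover have "g ` touching = Inl ` {v \<in> pverts G. Inl v \<in> U}"
  proof (intro equalityI subsetI)
    fix p :: "'a + ('a \<times> 'a \<times> nat) set" assume "p \<in> Inl ` {v \<in> pverts G. Inl v \<in> U}"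
    then obtain v where v: "p = Inl v" "v \<in> pverts G" "p \<in> U" by auto
    show "p \<in> g ` touching"
    proof (cases "p \<in> X")
      case True
      then show ?thesis using v by (intro image_eqI[of _ _ p]) (auto simp: touching_def g_def)
    next
      case False
      have "m p \<notin> Inl ` pverts G" using m_nbhd[of p] v k_pos by (auto simp: nbhd_Inl pt_inner)
      then show ?thesis using v False m_X m_m by (intro image_eqI[of _ _ "m p"]) (auto simp: touching_def g_def)
    qed
  next
    fix p assume "p \<in> g ` touching"
    then obtain x where x: "x \<in> touching" "p = g x" by blast
    then have "g x \<in> U" "g x \<in> Inl ` pverts G" using X_U m_U by (auto simp: touching_def g_def)
    moreover from this obtain v where "g x = Inl v" "v \<in> pverts G" by (elim imageE)
    ultimately show "p \<in> Inl ` {v \<in> pverts G. Inl v \<in> U}" using x(2) by simp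
  qed
  ultimately have "card touching = card (Inl ` {v \<in> pverts G. Inl v \<in> U} :: ('a + ('a \<times> 'a \<times> nat) set) set)"
    using card_image[of g touching] by simp
  then show ?thesis by (simp add: card_image)
qed

text \<open>Partners are adjacent, so the partner of an inner vertex is an inner vertex of the same
  edge or one of its ends.\<close>

lemma X_covered: "X \<subseteq> touching \<union> (\<Union>(u, v) \<in> R. matched_inside u v \<inter> X)"
proof
  fix x assume x: "x \<in> X"
  then have xU: "x \<in> U" "x \<in> pverts S" using X_U U_S by auto
  show "x \<in> touching \<union> (\<Union>(u, v) \<in> R. matched_inside u v \<inter> X)"
  proof (cases "x \<in> touching")
    case False
    then obtain u v i where uv: "(u, v) \<in> R" "i \<in> {1..k}" "x = pt u v i"
      using x xU(2) by (auto simp: touching_def pverts_S)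
    have arc: "(u, v) \<in> parcs G" using uv R_arcs by blast
    obtain j where j: "m x = pt u v j" "j \<le> Suc k"
      using m_nbhd[OF xU(1)] uv nbhd_inner[OF arc uv(2)] by force
    have "j \<noteq> 0" "j \<noteq> Suc k"
      using j(1) False x in_arcsD1[OF arc] in_arcsD2[OF arc] by (auto simp: touching_def)
    then have "m x \<in> inner u v" using j by force
    then have "x \<in> matched_inside u v" using uv xU by (auto simp: matched_inside_def)
    then show ?thesis using uv(1) x by blast
  qed simp
qed

lemma card_X_le_sum:
  "card X \<le> card {v \<in> pverts G. Inl v \<in> U} + (\<Sum>(u, v) \<in> R. card (matched_inside u v \<inter> X))"
proof -
  have fin: "finite X" using finite_U X_U finite_subset by blast
  then have "finite (touching \<union> (\<Union>(u, v) \<in> R. matched_inside u v \<inter> X))"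
    by (rule rev_finite_subset) (auto simp: touching_def)
  then have "card X \<le> card (touching \<union> (\<Union>(u, v) \<in> R. matched_inside u v \<inter> X))"
    using X_covered card_mono by blast
  also have "\<dots> \<le> card touching + card (\<Union>(u, v) \<in> R. matched_inside u v \<inter> X)"
    by (rule card_Un_le)
  also have "card (\<Union>(u, v) \<in> R. matched_inside u v \<inter> X) \<le> (\<Sum>(u, v) \<in> R. card (matched_inside u v \<inter> X))"
    using card_UN_le[OF finite_R, of "\<lambda>(u, v). matched_inside u v \<inter> X"] by (simp add: case_prod_unfold)
  finally show ?thesis by (simp add: card_touching)
qed

lemma card_X_le: "card X \<le> card (pverts G) + k div 2 * card R"
proof -
  have "(\<Sum>(u, v) \<in> R. card (matched_inside u v \<inter> X)) \<le> (\<Sum>e \<in> R. k div 2)"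
    using card_matched_inside_le R_arcs by (intro sum_mono) auto
  moreover have "card {v \<in> pverts G. Inl v \<in> U} \<le> card (pverts G)"
    using pair_finite_verts by (intro card_mono) auto
  ultimately show ?thesis using card_X_le_sum by (simp add: mult.commute)
qed

section \<open>The case of equality\<close>

context
  assumes extremal: "card X = card (pverts G) + k div 2 * card R" and odd_k: "odd k"
begin

text \<open>When the total attains the bound obtained summand by summand, every summand attains its
  own bound.\<close>

lemma Inl_matched: "v \<in> pverts G \<Longrightarrow> Inl v \<in> U"
  and matched_inside_extremal: "(u, v) \<in> R \<Longrightarrow> card (matched_inside u v \<inter> X) = k div 2"
proof -
  let ?V = "{v \<in> pverts G. Inl v \<in> U}"
  have le: "(case e of (u, v) \<Rightarrow> card (matched_inside u v \<inter> X)) \<le> k div 2" if "e \<in> R" for e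
    using that card_matched_inside_le R_arcs by (cases e) simp
  then have 1: "(\<Sum>(u, v) \<in> R. card (matched_inside u v \<inter> X)) \<le> (\<Sum>e \<in> R. k div 2)"
    by (intro sum_mono) auto
  have 2: "card ?V \<le> card (pverts G)"
    using pair_finite_verts by (intro card_mono) auto
  have ge: "card (pverts G) + (\<Sum>e \<in> R. k div 2) \<le> card ?V + (\<Sum>(u, v) \<in> R. card (matched_inside u v \<inter> X))"
    using card_X_le_sum extremal by (simp add: mult.commute)
  have "?V = pverts G"
    using card_seteq[of "pverts G" ?V] pair_finite_verts ge 1 by auto
  then show "v \<in> pverts G \<Longrightarrow> Inl v \<in> U" by blast
  have "(\<Sum>(u, v) \<in> R. card (matched_inside u v \<inter> X)) = (\<Sum>e \<in> R. k div 2)" using ge 1 2 by linarith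
  then show "(u, v) \<in> R \<Longrightarrow> card (matched_inside u v \<inter> X) = k div 2"
    using sum_mono_inv[of "\<lambda>(u, v). card (matched_inside u v \<inter> X)" R "\<lambda>_. k div 2" "(u, v)"] le finite_R
    by auto
qed

text \<open>The \<open>k div 2\<close> pairs inside the path cover, for odd \<open>k\<close>, all
  but one of its \<open>k\<close> inner vertices.\<close>

lemma inner_unmatched_unique:
  assumes "(u, v) \<in> parcs G" "p \<in> inner u v - matched_inside u v"
  shows "matched_inside u v = inner u v - {p}"
proof (rule card_seteq)
  \<comment> \<open>Equality is known for the direction in \<open>R\<close> only, but
    \<open>matched_inside\<close> does not depend on the direction.\<close>
  have "matched_inside v u = matched_inside u v" unfolding matched_inside_def inner_flip[of v u] ..
  then have "card (matched_inside u v \<inter> X) = k div 2"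
    using R_cases[OF assms(1)] matched_inside_extremal[of u v] matched_inside_extremal[of v u] by metis
  then have "card (matched_inside u v) = k - 1" using card_matched_inside[of u v] odd_k by presburger
  then show "card (inner u v - {p}) \<le> card (matched_inside u v)"
    using assms card_inner[OF assms(1)] by simp
qed (use assms in \<open>auto simp: matched_inside_def\<close>)

lemma first_unmatched_inside:
  assumes "m (pt v w 1) = Inl v"
  shows "pt v w 1 \<in> inner v w - matched_inside v w"
proof -
  have "m (pt v w 1) \<notin> inner v w" unfolding assms by (auto simp: pt_inner)
  moreover have "1 \<in> {1..k}" using k_pos by simp
  ultimately show ?thesis by (simp add: matched_inside_def)
qed

text \<open>Position 1 is taken by \<open>v\<close>, so positions 2 to \<open>k\<close> are paired
  among themselves, which forces the pairs \<open>2 * j\<close>, \<open>2 * j + 1\<close>. Partners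
  differ in membership in \<open>X\<close> and adjacent non-partners agree, so membership at
  \<open>2 * j\<close> flips with each \<open>j\<close>.\<close>

lemma alternating_step:
  assumes arc: "(v, w) \<in> parcs G" and m_v: "m (Inl v) = pt v w 1" and k4: "k mod 4 = 1"
  shows "Inl w \<in> X \<longleftrightarrow> Inl v \<notin> X"
proof -
  let ?s = "pt v w"
  have vU: "Inl v \<in> U" "Inl w \<in> U" using Inl_matched in_arcsD1[OF arc] in_arcsD2[OF arc] by auto
  have m1: "m (?s 1) = Inl v" using m_m[OF vU(1)] m_v by simp
  have neq: "?s i \<noteq> ?s j" if "i \<le> Suc k" "j \<le> Suc k" "i \<noteq> j" for i j
    using inj_onD[OF pt_inj_on[OF arc]] that by auto
  have inside: "?s i \<in> matched_inside v w" if "2 \<le> i" "i \<le> k" for i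
    using inner_unmatched_unique[OF arc first_unmatched_inside[OF m1]] that neq[of i 1] by simp
  have chain: "?s (2 * j) \<in> U \<and> m (?s (2 * j)) = ?s (Suc (2 * j)) \<and>
      (?s (2 * j) \<in> X \<longleftrightarrow> (Inl v \<in> X \<longleftrightarrow> even j))" if "Suc (2 * j) \<le> k" for j
    using that
  proof (induction j)
    case 0
    then show ?case using vU m_v by simp
  next
    case (Suc j)
    let ?i = "2 * j"
    have IH: "?s ?i \<in> U" "m (?s ?i) = ?s (Suc ?i)" "?s ?i \<in> X \<longleftrightarrow> (Inl v \<in> X \<longleftrightarrow> even j)"
      using Suc by auto
    have i2: "Suc (Suc ?i) \<in> {1..k}" and i1: "Suc ?i \<in> {1..k}" using Suc.prems by auto
    have U2: "?s (Suc (Suc ?i)) \<in> U"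
      using inside[of "Suc (Suc ?i)"] Suc.prems by (simp add: matched_inside_def)
    have U1: "?s (Suc ?i) \<in> U" "m (?s (Suc ?i)) = ?s ?i" using IH m_U m_m by metis+
    \<comment> \<open>The predecessor already has the partner \<open>?s ?i\<close>, which leaves the
      successor.\<close>
    have "m (?s (Suc (Suc ?i))) \<noteq> ?s (Suc ?i)"
      using m_m[OF U2] U1(2) neq[of ?i "Suc (Suc ?i)"] Suc.prems by auto
    then have "m (?s (Suc (Suc ?i))) = ?s (Suc (Suc (Suc ?i)))"
      using m_nbhd[OF U2] nbhd_inner[OF arc i2] by auto
    moreover have "?s (Suc (Suc ?i)) \<in> X \<longleftrightarrow> ?s (Suc ?i) \<in> X"
      using same_type[OF U1(1) U2] nbhd_inner[OF arc i1] U1(2) neq[of "Suc (Suc ?i)" ?i] Suc.prems by auto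
    moreover have "?s (Suc ?i) \<in> X \<longleftrightarrow> ?s ?i \<notin> X" using m_X[OF IH(1)] IH(2) by simp
    ultimately show ?case using U2 IH(3) by auto
  qed
  obtain q where q: "k = 4 * q + 1" using k4 by (metis mult_div_mod_eq)
  \<comment> \<open>The last pair has the even index \<open>2 * q\<close>, so
    \<open>?s (4 * q)\<close> agrees with \<open>v\<close> and \<open>?s k\<close> does not. The end
    \<open>w\<close> is not the partner of \<open>?s k\<close> and therefore agrees with it.\<close>
  have last: "?s (4 * q) \<in> U" "m (?s (4 * q)) = ?s k" "?s (4 * q) \<in> X \<longleftrightarrow> Inl v \<in> X"
    using chain[of "2 * q"] q by auto
  then have U: "?s k \<in> U" "m (?s k) = ?s (4 * q)" using m_U m_m by metis+
  have "Inl w \<in> nbhd S (?s k)" using nbhd_inner[OF arc, of k] k_pos by auto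
  moreover have "4 * q \<le> Suc k" "Suc k \<noteq> 4 * q" using q by simp_all
  then have "Inl w \<noteq> ?s (4 * q)" using neq[of "Suc k" "4 * q"] by simp
  ultimately have "Inl w \<in> X \<longleftrightarrow> ?s k \<in> X" using same_type[OF U(1) vU(2)] U(2) by simp
  then show ?thesis using m_X[OF last(1)] last by simp
qed

text \<open>The partner of \<open>v\<close> lies on the edge to \<open>t v\<close>. If
  \<open>t\<close> swapped \<open>u\<close> and \<open>v\<close>, the first inner vertices from both
  ends would be the single one unmatched inside, yet their partners differ.\<close>

lemma extremal_imp_alternating:
  assumes "k mod 4 = 1"
  obtains t c where "alternating G (pverts G) t c"
proof -
  have "\<exists>w. (v, w) \<in> parcs G \<and> m (Inl v) = pt v w 1" if "v \<in> pverts G" for v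
    using m_nbhd[OF Inl_matched[OF that]] by (auto simp: nbhd_Inl)
  then obtain t where t: "\<And>v. v \<in> pverts G \<Longrightarrow> (v, t v) \<in> parcs G \<and> m (Inl v) = pt v (t v) 1"
    by metis
  have "alternating G (pverts G) t (\<lambda>v. Inl v \<in> X)"
    unfolding alternating_def
  proof (intro conjI ballI inj_onI)
    fix u v assume uv: "u \<in> pverts G" "v \<in> pverts G" "{u, t u} = {v, t v}"
    show "u = v"
    proof (rule ccontr)
      assume "u \<noteq> v"
      then have tuv: "t u = v" "t v = u" using uv(3) by (auto simp: doubleton_eq_iff)
      have arc: "(u, v) \<in> parcs G" using t[OF uv(1)] tuv by simp
      have m: "m (pt u v 1) = Inl u" "m (pt v u 1) = Inl v"
        using t[OF uv(1)] t[OF uv(2)] m_m[OF Inl_matched] uv tuv by metis+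
      have "matched_inside v u = matched_inside u v" unfolding matched_inside_def inner_flip[of v u] ..
      then have "pt u v 1 \<in> inner u v - matched_inside u v" "pt v u 1 \<in> inner u v - matched_inside u v"
        using m[THEN first_unmatched_inside] inner_flip[of v u] by simp_all
      then have "pt u v 1 = pt v u 1" using inner_unmatched_unique[OF arc] by blast
      then show False using m \<open>u \<noteq> v\<close> by simp
    qed
  qed (use t alternating_step assms in auto)
  then show thesis using that by blast
qed

end

end

text \<open>Of the \<open>card (pverts G) + k * card R\<close> vertices at most
  \<open>card (pverts G) + k div 2 * card R\<close> are outside \<open>D\<close>, which leaves
  \<open>(k + 1) div 2\<close> per edge.\<close>

lemma super_dominating_set_card_ge:
  assumes "pair_graph G" "k mod 4 = 1" "super_dominating_set (k_subdivision k G) D"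
  shows "(k + 1) div 2 * edge_count G \<le> card D"
    and "card D = (k + 1) div 2 * edge_count G \<Longrightarrow> \<exists>t c. alternating G (pverts G) t c"
proof -
  interpret pair_graph G by fact
  let ?S = "k_subdivision k G"
  obtain R where R: "orientation G R" using orientation_extend[OF assms(1), of "{}"] by auto
  obtain U m where "private_matching ?S (pverts ?S - D) U m"
    using super_dominating_set_imp_private_matching[OF pair_graph_k_subdivision assms(3)] assms(1) by blast
  then interpret matched_subdivision G k R "pverts ?S - D" U m
    using R assms(2) by unfold_locales auto
  have "D \<subseteq> pverts ?S" using assms(3) by (simp add: super_dominating_set_def dominating_set_def)
  then have D: "card D + card (pverts ?S - D) = card (pverts G) + k * card R"
    using card_pverts_S finite_pverts_S card_mono[of "pverts ?S" D] by (simp add: card_Diff_subset finite_subset)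
  obtain q where q: "k = 4 * q + 1" using assms(2) by (metis mult_div_mod_eq)
  have k: "k * card R = (k + 1) div 2 * card R + k div 2 * card R"
    by (simp add: q algebra_simps)
  have e: "edge_count G = card R" using edge_count_eq_card_orientation[OF assms(1) R] .
  show "(k + 1) div 2 * edge_count G \<le> card D" using D k card_X_le e by simp
  show "\<exists>t c. alternating G (pverts G) t c" if "card D = (k + 1) div 2 * edge_count G"
  proof -
    have "card (pverts ?S - D) = card (pverts G) + k div 2 * card R" using D k e that by simp
    moreover have "odd k" using q by simp
    ultimately show ?thesis using extremal_imp_alternating assms(2) by metis
  qed
qed

section \<open>The construction\<close>

text \<open>The pattern separates the residues 0, 1 from 2, 3. It splits every pair
  \<open>j\<close>, \<open>j + 1\<close> with odd \<open>j\<close>, and any two positions at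
  distance 2.\<close>

lemma mod_4_less_2_Suc: "odd j \<Longrightarrow> (Suc j mod 4 < 2) \<noteq> (j mod 4 < 2)"
  and mod_4_less_2_Suc_Suc: "(Suc (Suc j) mod 4 < 2) \<noteq> (j mod 4 < 2)"
  for j :: nat
  by presburger+

text \<open>Each block of four consecutive positions has two in either class.\<close>

lemma card_mod_4_pattern: "card {j \<in> {1..4 * q}. (j mod 4 < 2) = b} = 2 * (q::nat)"
proof -
  have "(\<Sum>j = 1..4 * q. if (j mod 4 < 2) = b then 1 else 0) = 2 * q"
  proof (induction q)
    case (Suc q)
    have 4: "4 * Suc q = Suc (Suc (Suc (Suc (4 * q))))" by simp
    show ?case unfolding 4 sum.cl_ivl_Suc using Suc by (cases b) (simp_all add: mod_Suc)
  qed simp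
  then show ?thesis by (simp add: sum.If_cases Int_def)
qed

text \<open>Directing a used edge from \<open>t v\<close> to \<open>v\<close> puts its position
  \<open>k\<close>, which is outside the pattern, next to \<open>v\<close> as the partner of
  \<open>v\<close>. An original vertex outside \<open>A\<close> gets no partner, so
  \<open>c_A\<close> keeps it out of \<open>X\<close>.\<close>

locale alternating_subdivision = oriented_subdivision G k R
  for G :: "'a pair_pre_digraph" and k R +
  fixes A t c q
  assumes alternating: "alternating G A t c" and t_R: "v \<in> A \<Longrightarrow> (t v, v) \<in> R"
    and c_A: "c v \<Longrightarrow> v \<in> pverts G \<Longrightarrow> v \<in> A" and k_eq: "k = 4 * q + 1"
begin

text \<open>An edge used by \<open>t\<close> is perfectly matched together with the endpoint using it; on every other
  edge the last inner vertex, which is the one at distance \<open>k\<close> from the tail in \<open>R\<close>, stays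
  unmatched. In both cases the pairs \<open>1, 2\<close>; \<open>3, 4\<close>; ... of inner vertices follow a pattern
  of period 4.\<close>
definition X where
  "X = Inl ` {v \<in> pverts G. c v} \<union>
     (\<Union>(b, a) \<in> R. pt b a ` {j \<in> {1..4 * q}. (j mod 4 < 2) = c b}) \<union>
     (\<lambda>v. pt (t v) v k) ` {v \<in> A. \<not> c v}"

lemma A_verts: "A \<subseteq> pverts G" and t_arc: "v \<in> A \<Longrightarrow> (v, t v) \<in> parcs G"
  and c_t: "v \<in> A \<Longrightarrow> c (t v) \<longleftrightarrow> \<not> c v"
  using alternating by (auto simp: alternating_def)

lemma less_k: "4 * q < k"
  by (simp add: k_eq)

lemma Inl_in_X: "Inl v \<in> X \<longleftrightarrow> v \<in> pverts G \<and> c v"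
  using k_pos less_k by (auto simp: X_def pt_inner)

text \<open>Both inner parts of \<open>X\<close> use descriptions directed by \<open>R\<close>, so
  positions can be compared. At position \<open>k\<close> the condition \<open>c b\<close> amounts
  to \<open>\<not> c a\<close>, because \<open>b = t a\<close>.\<close>

lemma pt_in_X:
  assumes "(b, a) \<in> R" "j \<in> {1..k}"
  shows "pt b a j \<in> X \<longleftrightarrow> (if j = k then a \<in> A \<and> b = t a \<and> c b else (j mod 4 < 2) = c b)"
proof -
  have "pt b a j \<notin> Inl ` B" for B using assms(2) by (auto simp: pt_inner)
  moreover have "pt b a j \<in> (\<Union>(b, a) \<in> R. pt b a ` {j \<in> {1..4 * q}. (j mod 4 < 2) = c b}) \<longleftrightarrow>
      j \<noteq> k \<and> (j mod 4 < 2) = c b" (is "_ \<in> ?X2 \<longleftrightarrow> ?r")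
  proof
    assume "pt b a j \<in> ?X2"
    then obtain b' a' i where *: "(b', a') \<in> R" "i \<in> {1..4 * q}" "(i mod 4 < 2) = c b'" "pt b a j = pt b' a' i"
      by auto
    then have "i \<in> {1..k}" by (auto simp: k_eq)
    then have "b' = b \<and> a' = a \<and> i = j" using pt_R_inj[OF assms(2) _ assms(1) *(1) *(4)] by blast
    then show ?r using * by (auto simp: k_eq)
  next
    assume ?r
    then have "j \<in> {j \<in> {1..4 * q}. (j mod 4 < 2) = c b}" using assms(2) by (auto simp: k_eq)
    then show "pt b a j \<in> ?X2" using assms(1) by blast
  qed
  moreover have "pt b a j \<in> (\<lambda>v. pt (t v) v k) ` {v \<in> A. \<not> c v} \<longleftrightarrow> j = k \<and> a \<in> A \<and> b = t a \<and> c b"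
    (is "_ \<in> ?X3 \<longleftrightarrow> ?r")
  proof
    assume "pt b a j \<in> ?X3"
    then obtain v where v: "v \<in> A" "\<not> c v" "pt b a j = pt (t v) v k" by auto
    have "k \<in> {1..k}" using k_pos by simp
    then show ?r using pt_R_inj[OF assms(2) _ assms(1) t_R[OF v(1)] v(3)] v c_t by auto
  next
    assume ?r
    then show "pt b a j \<in> ?X3" using c_t[of a] by auto
  qed
  ultimately show ?thesis unfolding X_def by (auto simp del: UN_iff)
qed

lemma pt_in_S: "(b, a) \<in> R \<Longrightarrow> j \<in> {1..k} \<Longrightarrow> pt b a j \<in> pverts S"
  unfolding pverts_S by (intro UnI2 UN_I) auto

lemma X_verts: "X \<subseteq> pverts S"
proof -
  have "pt (t v) v k \<in> inner (t v) v" for v using k_pos by simp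
  then have "(\<lambda>v. pt (t v) v k) ` {v \<in> A. \<not> c v} \<subseteq> (\<Union>(b, a) \<in> R. inner b a)"
    using t_R by blast
  moreover have "(\<Union>(b, a) \<in> R. pt b a ` {j \<in> {1..4 * q}. (j mod 4 < 2) = c b}) \<subseteq> (\<Union>(b, a) \<in> R. inner b a)"
    by (intro UN_mono) (auto simp: k_eq)
  moreover have "(Inl ` {v \<in> pverts G. c v} :: ('a + ('a \<times> 'a \<times> nat) set) set) \<subseteq> Inl ` pverts G" by blast
  ultimately show ?thesis unfolding X_def pverts_S by (meson Un_least le_supI1 le_supI2)
qed

text \<open>Every edge contributes \<open>2 * q\<close> positions of the pattern. Each
  \<open>v\<close> in \<open>A\<close> adds one vertex: itself if \<open>c v\<close>, otherwise its
  partner at position \<open>k\<close>.\<close>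

lemma card_X: "card X = 2 * q * card R + card A"
proof -
  let ?X1 = "Inl ` {v \<in> pverts G. c v} :: ('a + ('a \<times> 'a \<times> nat) set) set"
  let ?B = "\<lambda>(b, a). pt b a ` {j \<in> {1..4 * q}. (j mod 4 < 2) = c b}"
  let ?X3 = "(\<lambda>v. pt (t v) v k) ` {v \<in> A. \<not> c v}"
  have k1: "k \<in> {1..k}" using k_pos by simp
  have sub: "?B e \<subseteq> (case e of (u, v) \<Rightarrow> inner u v)" for e by (cases e) (auto simp: k_eq)
  have finA: "finite A" using A_verts pair_finite_verts finite_subset by blast
  have "card ?X1 = card {v \<in> A. c v}"
    using A_verts c_A by (auto simp: card_image intro!: arg_cong[of _ _ card])
  moreover have "card (\<Union>e \<in> R. ?B e) = 2 * q * card R"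
  proof -
    have "card (?B e) = 2 * q" if "e \<in> R" for e
    proof -
      obtain b a where e: "e = (b, a)" by (cases e)
      have "inj_on (pt b a) {j \<in> {1..4 * q}. (j mod 4 < 2) = c b}"
        by (rule inj_on_subset[OF pt_inj_on]) (use that R_arcs in \<open>auto simp: e k_eq\<close>)
      then show ?thesis unfolding e prod.case by (simp only: card_image card_mod_4_pattern)
    qed
    moreover have "?B e \<inter> ?B e' = {}" if "e \<in> R" "e' \<in> R" "e \<noteq> e'" for e e'
      using Int_mono[OF sub[of e] sub[of e']] unfolding inner_disjoint[OF that] by (rule subset_empty[THEN iffD1])
    ultimately have "card (\<Union>e \<in> R. ?B e) = (\<Sum>e \<in> R. 2 * q)"
      using finite_R by (subst card_UN_disjoint) auto
    then show ?thesis by simp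
  qed
  moreover have "card ?X3 = card {v \<in> A. \<not> c v}"
    using pt_R_inj[OF k1 k1 t_R t_R] by (intro card_image inj_onI) auto
  moreover have "?X1 \<inter> (\<Union>e \<in> R. ?B e) = {}" "(?X1 \<union> (\<Union>e \<in> R. ?B e)) \<inter> ?X3 = {}"
  proof -
    show "?X1 \<inter> (\<Union>e \<in> R. ?B e) = {}" using less_k by (auto simp: pt_inner)
    define Y where "Y = ?X1 \<union> (\<Union>e \<in> R. ?B e)"
    have "pt (t v) v k \<notin> Y" if "v \<in> A" for v
    proof
      assume "pt (t v) v k \<in> Y"
      then obtain b a j where "(b, a) \<in> R" "j \<in> {1..4 * q}" "pt (t v) v k = pt b a j"
        using pt_inner_neq_Inl[OF k1, of "t v" v] by (auto simp: Y_def simp del: One_nat_def)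
      then show False using pt_R_inj[OF k1 _ t_R[OF that], of j b a] by (auto simp: k_eq)
    qed
    then show "(?X1 \<union> (\<Union>e \<in> R. ?B e)) \<inter> ?X3 = {}" unfolding Y_def[symmetric] by blast
  qed
  moreover have "finite ?X1" "finite (\<Union>e \<in> R. ?B e)" "finite ?X3"
    using pair_finite_verts finite_R finA by (auto simp: case_prod_unfold)
  moreover have "X = ?X1 \<union> (\<Union>e \<in> R. ?B e) \<union> ?X3" by (simp add: X_def)
  moreover have "card A = card {v \<in> A. c v} + card {v \<in> A. \<not> c v}"
    using card_Int_Diff[OF finA, of "Collect c"] by (simp add: Int_def set_diff_eq)
  ultimately show ?thesis by (simp add: card_Un_disjoint)
qed

text \<open>The other neighbour of position \<open>k\<close> is position \<open>4 * q\<close>, of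
  residue 0; it would be in \<open>X\<close> only if \<open>c (t v)\<close>, which contradicts
  \<open>c v\<close>.\<close>

lemma private_neighbour_Inl:
  assumes "Inl v \<in> X"
  shows "pt (t v) v k \<in> pverts S - X \<and> nbhd S (pt (t v) v k) \<inter> X = {Inl v}"
proof -
  have v: "c v" "v \<in> A" "\<not> c (t v)" "(t v, v) \<in> R" using assms c_A c_t t_R by (auto simp: Inl_in_X)
  have k1: "k \<in> {1..k}" using k_pos by simp
  have "pt (t v) v (k - 1) \<notin> X"
  \<comment> \<open>For \<open>q = 0\<close> position \<open>k - 1\<close> is the end
    \<open>t v\<close> itself.\<close>
  proof (cases "q = 0")
    case False
    then have "k - 1 \<in> {1..k}" "k - 1 \<noteq> k" "(k - 1) mod 4 < 2" by (auto simp: k_eq)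
    then show ?thesis using pt_in_X[OF v(4), of "k - 1"] v by simp
  next
    case True
    then have "k - 1 = 0" by (simp add: k_eq)
    then show ?thesis using v(3) by (simp add: Inl_in_X)
  qed
  moreover have "pt (t v) v k \<notin> X" using pt_in_X[OF v(4) k1] v by simp
  moreover have "pt (t v) v k \<in> pverts S" using pt_in_S[OF v(4) k1] .
  ultimately show ?thesis using nbhd_inner[OF R_arcs[OF v(4)] k1] assms by auto
qed

text \<open>A neighbour at position 1 of an edge directed away from \<open>v\<close> is in
  \<open>X\<close> only if \<open>c v\<close>; one at position \<open>k\<close> of an edge directed
  to \<open>v\<close> is in \<open>X\<close> only if that edge comes from
  \<open>t v\<close>.\<close>

lemma private_neighbour_last:
  assumes "v \<in> A" "\<not> c v"
  shows "Inl v \<in> pverts S - X \<and> nbhd S (Inl v) \<inter> X = {pt (t v) v k}"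
proof -
  have k1: "k \<in> {1..k}" "1 \<in> {1..k}" using k_pos by auto
  have R: "(t v, v) \<in> R" using t_R assms by blast
  have kX: "pt (t v) v k \<in> X" using pt_in_X[OF R k1(1)] assms c_t by simp
  have flip: "pt v (t v) 1 = pt (t v) v k" using pt_flip[of 1 "t v" v] by simp
  have unique: "u = t v" if "(v, u) \<in> parcs G" "pt v u 1 \<in> X" for u
  proof (cases "(v, u) \<in> R")
    case True
    then show ?thesis using that pt_in_X[OF True k1(2)] assms by (auto split: if_splits)
  next
    case False
    then have "(u, v) \<in> R" using R_cases that by blast
    moreover have "pt u v k \<in> X" using pt_flip[of 1 u v] that(2) by simp
    ultimately show ?thesis using pt_in_X[OF _ k1(1)] by auto
  qed
  have "nbhd S (Inl v) \<inter> X = {pt (t v) v k}"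
  proof (intro equalityI subsetI)
    fix p assume "p \<in> nbhd S (Inl v) \<inter> X"
    then obtain u where "(v, u) \<in> parcs G" "p = pt v u 1" "p \<in> X" unfolding nbhd_Inl by blast
    then show "p \<in> {pt (t v) v k}" using unique[of u] flip by simp
  next
    fix p assume "p \<in> {pt (t v) v k}"
    then have "p = pt v (t v) 1" "p \<in> X" using flip kX by simp_all
    then show "p \<in> nbhd S (Inl v) \<inter> X" unfolding nbhd_Inl using t_arc[OF assms(1)] by blast
  qed
  moreover have "Inl v \<in> pverts S - X" using assms A_verts by (auto simp: Inl_in_X pverts_S)
  ultimately show ?thesis by blast
qed

text \<open>The partner \<open>i\<close> of \<open>j\<close> dominates it privately: a change of
  class keeps both \<open>i\<close> and its other neighbour, at distance 2 from \<open>j\<close>,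
  out of \<open>X\<close>. The two ends of the path need separate arguments.\<close>

lemma private_neighbour_inner:
  assumes "(b, a) \<in> R" "j \<in> {1..4 * q}" "(j mod 4 < 2) = c b"
  shows "\<exists>y \<in> pverts S - X. nbhd S y \<inter> X = {pt b a j}"
proof -
  have b: "b \<in> pverts G" using assms(1) R_arcs in_arcsD1 by blast
  define i where "i = (if odd j then Suc j else j - 1)"
  have ijk: "i \<in> {1..k}" "j \<in> {1..k}" "i \<noteq> k" "j \<noteq> k" using assms(2) by (auto simp: i_def k_eq)
  have "(i mod 4 < 2) \<noteq> (j mod 4 < 2)"
    using mod_4_less_2_Suc[of j] mod_4_less_2_Suc[of "j - 1"] assms(2) by (cases "odd j") (simp_all add: i_def)
  then have iX: "pt b a i \<notin> X" and jX: "pt b a j \<in> X"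
    using pt_in_X[OF assms(1), of i] pt_in_X[OF assms(1), of j] ijk assms(3) by auto
  have "nbhd S (pt b a i) \<inter> X = {pt b a j}"
  proof (cases "odd j")
    case True
    then have i: "i = Suc j" by (simp add: i_def)
    have "pt b a (Suc i) \<notin> X"
    \<comment> \<open>Position \<open>k\<close> does not follow the pattern, but here
      \<open>j\<close> has residue 3, so \<open>c b\<close> fails and position \<open>k\<close> is
      not in \<open>X\<close>.\<close>
    proof (cases "Suc i = k")
      case True
      then have "j mod 4 = 3" using i assms(2) by (simp add: k_eq) presburger
      then show ?thesis using True pt_in_X[OF assms(1), of k] k_pos assms(3) by simp
    next
      case False
      have "(Suc i mod 4 < 2) \<noteq> (j mod 4 < 2)" using i mod_4_less_2_Suc_Suc by simp
      then show ?thesis using pt_in_X[OF assms(1), of "Suc i"] False ijk assms(3) by auto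
    qed
    then show ?thesis using nbhd_inner[OF R_arcs[OF assms(1)] ijk(1)] i jX by auto
  next
    case False
    then have i: "j = Suc i" using assms(2) by (auto simp: i_def)
    have "pt b a (i - 1) \<notin> X"
    \<comment> \<open>Here the other neighbour is the end \<open>b\<close>, and \<open>j = 2\<close>
      means that \<open>c b\<close> fails.\<close>
    proof (cases "i = 1")
      case True
      then show ?thesis using i assms(3) by (simp add: Inl_in_X)
    next
      case False
      have "((i - 1) mod 4 < 2) \<noteq> (j mod 4 < 2)"
        using i False ijk(1) mod_4_less_2_Suc_Suc[of "i - 1"] by simp
      moreover have "i - 1 \<in> {1..k}" "i - 1 \<noteq> k" using ijk(1) False by auto
      ultimately show ?thesis using pt_in_X[OF assms(1), of "i - 1"] assms(3) by simp
    qed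
    then show ?thesis using nbhd_inner[OF R_arcs[OF assms(1)] ijk(1)] i jX by auto
  qed
  moreover have "pt b a i \<in> pverts S" using pt_in_S[OF assms(1) ijk(1)] .
  ultimately show ?thesis using iX by blast
qed

lemma super_dominating: "super_dominating_set S (pverts S - X)"
proof -
  have X: "pverts S - (pverts S - X) = X" using X_verts by blast
  have priv: "\<exists>y \<in> pverts S - X. nbhd S y \<inter> X = {x}" if x: "x \<in> X" for x
  proof -
    consider v where "x = Inl v" | b a j where "(b, a) \<in> R" "j \<in> {1..4 * q}" "(j mod 4 < 2) = c b" "x = pt b a j"
      | v where "v \<in> A" "\<not> c v" "x = pt (t v) v k"
      using x by (auto simp: X_def)
    then show ?thesis
    proof cases
      case 1
      then show ?thesis using private_neighbour_Inl x by blast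
    next
      case 2
      then show ?thesis using private_neighbour_inner by blast
    next
      case 3
      then show ?thesis using private_neighbour_last by blast
    qed
  qed
  interpret S: pair_graph S using pair_graph_k_subdivision pair_graph .
  have "nbhd S x \<inter> (pverts S - X) \<noteq> {}" if x: "x \<in> X" for x
  proof -
    obtain y where "y \<in> pverts S - X" "x \<in> nbhd S y" using priv[OF x] by blast
    then show ?thesis using S.arcs_symmetric by (auto simp: nbhd_def)
  qed
  then show ?thesis
    unfolding super_dominating_set_def dominating_set_def X using priv by blast
qed

end

text \<open>Here \<open>D\<close> is the complement of the constructed \<open>X\<close>, so every
  vertex missing from \<open>A\<close> costs one more vertex in \<open>D\<close>.\<close>

lemma alternating_imp_super_dominating_set:
  assumes "pair_graph G" "k mod 4 = 1" "alternating G A t c"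
    and "\<And>v. v \<in> pverts G \<Longrightarrow> c v \<Longrightarrow> v \<in> A"
  obtains D where "super_dominating_set (k_subdivision k G) D"
    "card D + card A = (k + 1) div 2 * edge_count G + card (pverts G)"
proof -
  interpret pair_graph G by fact
  obtain q where q: "k = 4 * q + 1" using assms(2) by (metis mult_div_mod_eq)
  \<comment> \<open>Without swaps the arcs from \<open>t v\<close> to \<open>v\<close> never include
    both directions of an edge, so they extend to an orientation.\<close>
  have no_swap: "\<not> (u \<in> A \<and> v \<in> A \<and> t u = v \<and> t v = u)" for u v
  proof
    assume *: "u \<in> A \<and> v \<in> A \<and> t u = v \<and> t v = u"
    then have "u = v"
      using assms(3) unfolding alternating_def inj_on_def by (metis insert_commute)
    then show False using * assms(3) by (auto simp: alternating_def)
  qed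
  have "(\<lambda>v. (t v, v)) ` A \<subseteq> parcs G"
    using assms(3) arcs_symmetric unfolding alternating_def by blast
  then obtain R where R: "orientation G R" "(\<lambda>v. (t v, v)) ` A \<subseteq> R"
    using orientation_extend[OF assms(1), of "(\<lambda>v. (t v, v)) ` A"] no_swap by blast
  interpret alternating_subdivision G k R A t c q
    using R q assms(3,4) by unfold_locales auto
  have "card (pverts S - X) + card X = card (pverts G) + k * card R"
    using card_pverts_S finite_pverts_S X_verts card_mono[of "pverts S" X]
    by (simp add: card_Diff_subset finite_subset)
  moreover have "k * card R = (k + 1) div 2 * card R + 2 * q * card R" by (simp add: q algebra_simps)
  ultimately have "card (pverts S - X) + card A = (k + 1) div 2 * card R + card (pverts G)"
    using card_X by linarith
  then show thesis
    using that super_dominating edge_count_eq_card_orientation[OF assms(1) R(1)] by simp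
qed

section \<open>Matching the lower bound with the construction\<close>

theorem theorem5p5:
  fixes G :: "'a pair_pre_digraph" and k :: nat
  assumes "pair_graph G"
    and "Digraph_Component.connected (with_proj G)"
    and "k > 0"
    and "k mod 4 = 1"
  shows "super_domination_number (k_subdivision k G) =
           (if contains_even_cycle G
            then (k + 1) div 2 * edge_count G
            else (k + 1) div 2 * edge_count G + 1)"
proof -
  interpret pair_graph G by fact
  interpret S: pair_graph "k_subdivision k G" using pair_graph_k_subdivision assms(1) .
  let ?F = "{D. super_dominating_set (k_subdivision k G) D}"
  have "?F \<subseteq> Pow (pverts (k_subdivision k G))"
    by (auto simp: super_dominating_set_def dominating_set_def)
  then have fin: "finite (card ` ?F)" using S.pair_finite_verts finite_subset by blast
  have min: "super_domination_number (k_subdivision k G) = n"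
    if "super_dominating_set (k_subdivision k G) D" "card D = n"
      and "\<And>D. super_dominating_set (k_subdivision k G) D \<Longrightarrow> n \<le> card D" for D n
    unfolding super_domination_number_def using that by (intro Min_eqI[OF fin]) auto
  note lower = super_dominating_set_card_ge[OF assms(1,4)]
  show ?thesis
  proof (cases "contains_even_cycle G")
    case True
    obtain t c where "alternating G (pverts G) t c"
      using even_cycle_imp_alternating[OF assms(1,2) True] .
    then obtain D where "super_dominating_set (k_subdivision k G) D"
        "card D + card (pverts G) = (k + 1) div 2 * edge_count G + card (pverts G)"
      using alternating_imp_super_dominating_set[OF assms(1,4)] by metis
    then have "super_domination_number (k_subdivision k G) = (k + 1) div 2 * edge_count G"
      using min lower(1) by simp
    then show ?thesis using True by simp
  next
    case False
    obtain r t c where r: "r \<in> pverts G" "alternating G (pverts G - {r}) t c" "\<not> c r"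
      using alternating_remove_root[OF assms(1,2)] .
    then obtain D where D: "super_dominating_set (k_subdivision k G) D"
        "card D + card (pverts G - {r}) = (k + 1) div 2 * edge_count G + card (pverts G)"
      using alternating_imp_super_dominating_set[OF assms(1,4) r(2)] by blast
    \<comment> \<open>The root, the only vertex outside the domain of \<open>t\<close>, accounts for
      the extra 1.\<close>
    have "card D = (k + 1) div 2 * edge_count G + 1"
      using D(2) card_Suc_Diff1[OF pair_finite_verts r(1)] by linarith
    moreover have "(k + 1) div 2 * edge_count G + 1 \<le> card D'"
      if "super_dominating_set (k_subdivision k G) D'" for D'
    proof -
      \<comment> \<open>Equality would give an alternating map on all vertices and hence an even
        cycle.\<close>
      have "card D' \<noteq> (k + 1) div 2 * edge_count G"
        using lower(2)[OF that] alternating_imp_even_cycle[OF assms(1)] r(1) False by blast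
      then show ?thesis using lower(1)[OF that] by linarith
    qed
    ultimately have "super_domination_number (k_subdivision k G) = (k + 1) div 2 * edge_count G + 1"
      using min[OF D(1)] by blast
    then show ?thesis using False by simp
  qed
qed

end
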